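(* For every integer $m$, there exists a finite simple graph $G$ such that $\mathrm{minrk}_{\mathbb{R}}(\overline{G})\leq3$ and $\chi(G)\geq m$.
   Context: For a graph $G$ on vertex set $[n]$, a matrix $M\in\mathbb{R}^{n\times n}$ represents $G$ if $M_{i,i}\neq0$ for all $i$ and $M_{i,j}=0$ for all distinct non-adjacent $i,j$. $\mathrm{minrk}_{\mathbb{R}}(G)$ is the minimum rank of a real matrix representing $G$. $\overline{G}$ is the complement of $G$ and $\chi$ the chromatic number. *)

theory Defs
  imports "Graph_Theory.Pair_Digraph" "Jordan_Normal_Form.DL_Rank"
begin

text \<open>
  Finite simple graphs are the symmetric, loop-free, finite digraphs of the library
  (locale \<^locale>\<open>pair_graph\<close>): an edge \<open>{u, v}\<close> is the pair of arcs \<open>(u, v)\<close>, \<open>(v, u)\<close>.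
  Rows and columns of matrices are numbered from 0, so the vertex set \<open>[n]\<close> is
  \<^term>\<open>{..<n::nat}\<close>.
\<close>

definition graph_on :: "nat \<Rightarrow> nat pair_pre_digraph \<Rightarrow> bool" where
  "graph_on n G \<longleftrightarrow> pair_graph G \<and> pverts G = {..<n}"

definition complement_graph :: "'a pair_pre_digraph \<Rightarrow> 'a pair_pre_digraph" where
  "complement_graph G =
     \<lparr>pverts = pverts G,
      parcs = {(u, v) \<in> pverts G \<times> pverts G. u \<noteq> v \<and> (u, v) \<notin> parcs G}\<rparr>"

definition proper_coloring :: "'a pair_pre_digraph \<Rightarrow> nat \<Rightarrow> ('a \<Rightarrow> nat) \<Rightarrow> bool" where
  "proper_coloring G k c \<longleftrightarrow>
     c ` pverts G \<subseteq> {..<k} \<and> (\<forall>(u, v) \<in> parcs G. c u \<noteq> c v)"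

definition chromatic_number :: "'a pair_pre_digraph \<Rightarrow> nat" where
  "chromatic_number G = (LEAST k. \<exists>c. proper_coloring G k c)"

definition represents :: "nat \<Rightarrow> real mat \<Rightarrow> nat pair_pre_digraph \<Rightarrow> bool" where
  "represents n M G \<longleftrightarrow>
     M \<in> carrier_mat n n \<and>
     (\<forall>i<n. M $$ (i, i) \<noteq> 0) \<and>
     (\<forall>i<n. \<forall>j<n. i \<noteq> j \<and> (i, j) \<notin> parcs G \<longrightarrow> M $$ (i, j) = 0)"

text \<open>
  The rank is that of the vector space \<open>\<real>\<^sup>n\<close> of column vectors, whose dimension
  is a parameter of \<^const>\<open>vec_space.rank\<close>. The minimum exists, since the identity
  matrix represents every graph.
\<close>

definition minrk :: "nat \<Rightarrow> nat pair_pre_digraph \<Rightarrow> nat" where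
  "minrk n G = (LEAST r. \<exists>M. represents n M G \<and> vec_space.rank n M = r)"

end

theory Submission
  imports Defs
begin

text \<open>
  Let \<open>G\<close> be the double shift graph: its vertices are the triples \<open>a < b < c\<close> of numbers below
  \<open>N\<close>, and \<open>(a, b, c)\<close> is joined to \<open>(b, c, d)\<close>. Take the points \<open>x\<^sub>a = (1, a, a\<^sup>2)\<close> on the moment
  curve, and attach to \<open>(a, b, c)\<close> the pair of vectors \<open>x\<^sub>a \<times> x\<^sub>c\<close> and \<open>x\<^sub>b\<close> of \<open>\<real>\<^sup>3\<close>. Up to a
  nonzero row factor, the inner product of the first vector of \<open>(a, b, c)\<close> with the second
  vector of \<open>(a', b', c')\<close> is \<open>(b' - a) (b' - c)\<close>, which is nonzero on the diagonal and vanishes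
  on adjacent triples. So the complement of \<open>G\<close> has minrank at most 3. On the other hand, a proper
  colouring of \<open>G\<close> with \<open>k\<close> colours forces \<open>N \<le> 2 ^ 2 ^ k\<close>.
\<close>

text \<open>Each summand is an outer product, of rank at most 1, and rank is subadditive.\<close>

lemma (in vec_space) rank_le_sum_products:
  fixes f g :: "nat \<Rightarrow> nat \<Rightarrow> 'a"
  shows "rank (mat n nc (\<lambda>(i, j). \<Sum>t<k. f t i * g t j)) \<le> k"
proof (induction k)
  case 0
  have "mat n nc (\<lambda>(i, j). \<Sum>t<0. f t i * g t j) = 0\<^sub>m n nc"
    by (intro eq_matI) auto
  then show ?case
    by (simp only: rank_0I le_refl)
next
  case (Suc k)
  let ?S = "mat n nc (\<lambda>(i, j). \<Sum>t<k. f t i * g t j)"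
  let ?P = "mat n nc (\<lambda>(i, j). f k i * g k j)"
  have "mat n nc (\<lambda>(i, j). \<Sum>t<Suc k. f t i * g t j) = ?S + ?P"
    by (intro eq_matI) auto
  moreover have "rank (?S + ?P) \<le> rank ?S + rank ?P"
    by (rule rank_subadditive) auto
  moreover have "rank ?P \<le> 1"
    by (rule rank_le_1_product_entries[where f = "f k" and g = "g k"]) auto
  ultimately show ?case
    using Suc by simp
qed

lemma minrk_le:
  assumes "represents n M G" "vec_space.rank n M \<le> r"
  shows "minrk n G \<le> r"
proof -
  have "minrk n G \<le> vec_space.rank n M"
    unfolding minrk_def using assms(1) by (intro Least_le) auto
  then show ?thesis
    using assms(2) by simp
qed

lemma chromatic_number_coloring:
  assumes "graph_on n G"
  obtains c where "proper_coloring G (chromatic_number G) c"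
proof -
  interpret pair_graph G
    using assms by (simp add: graph_on_def)
  \<comment> \<open>Since the vertices themselves serve as colours, the \<open>LEAST\<close> ranges
    over a nonempty set and is attained.\<close>
  have "proper_coloring G n id"
    using assms pair_no_loops by (fastforce simp: proper_coloring_def graph_on_def)
  then have "\<exists>c. proper_coloring G n c"
    by blast
  then have "\<exists>c. proper_coloring G (chromatic_number G) c"
    unfolding chromatic_number_def by (rule LeastI[where P = "\<lambda>k. \<exists>c. proper_coloring G k c"])
  then show ?thesis
    using that by blast
qed

text \<open>
  A colouring of triples induces one of pairs, by the set of colours of the triples that extend
  the pair, and then one of numbers in the same way. The latter is injective.
\<close>

lemma shift_coloring_bound:
  fixes col :: "nat \<Rightarrow> nat \<Rightarrow> nat \<Rightarrow> nat"
  assumes bound: "\<And>a b c. a < b \<Longrightarrow> b < c \<Longrightarrow> c < N \<Longrightarrow> col a b c < k"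
    and proper: "\<And>a b c d. a < b \<Longrightarrow> b < c \<Longrightarrow> c < d \<Longrightarrow> d < N \<Longrightarrow> col a b c \<noteq> col b c d"
  shows "N \<le> 2 ^ 2 ^ k"
proof -
  define \<phi> where "\<phi> a b = {col a b c |c. b < c \<and> c < N}" for a b
  define \<Phi> where "\<Phi> a = {\<phi> a b |b. a < b \<and> b < N}" for a
  have \<phi>_neq: "\<phi> a b \<noteq> \<phi> b c" if "a < b" "b < c" "c < N" for a b c
  proof -
    have "col a b c \<in> \<phi> a b"
      using that by (auto simp: \<phi>_def)
    \<comment> \<open>Every member of \<open>\<phi> b c\<close> is some \<open>col b c d\<close>,
      the colour of a neighbour of \<open>(a, b, c)\<close>.\<close>
    moreover have "col a b c \<notin> \<phi> b c"
      using that proper by (auto simp: \<phi>_def)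
    ultimately show ?thesis
      by blast
  qed
  have \<Phi>_neq: "\<Phi> a \<noteq> \<Phi> b" if "a < b" "b < N" for a b
  proof -
    have "\<phi> a b \<in> \<Phi> a"
      using that by (auto simp: \<Phi>_def)
    moreover have "\<phi> a b \<notin> \<Phi> b"
      using that \<phi>_neq by (auto simp: \<Phi>_def)
    ultimately show ?thesis
      by blast
  qed
  have "inj_on \<Phi> {..<N}"
    by (rule linorder_inj_onI) (use \<Phi>_neq in auto)
  moreover have "\<Phi> ` {..<N} \<subseteq> Pow (Pow {..<k})"
    using bound by (auto simp: \<Phi>_def \<phi>_def)
  ultimately have "card {..<N} \<le> card (Pow (Pow {..<k}))"
    by (intro card_inj_on_le) auto
  then show ?thesis
    by (simp add: card_Pow)
qed

definition shift_triples :: "nat \<Rightarrow> (nat \<times> nat \<times> nat) set" where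
  "shift_triples N = {(a, b, c). a < b \<and> b < c \<and> c < N}"

definition shift_adj :: "nat \<times> nat \<times> nat \<Rightarrow> nat \<times> nat \<times> nat \<Rightarrow> bool" where
  "shift_adj = (\<lambda>(a, b, c) (a', b', c'). b = a' \<and> c = b')"

text \<open>The map \<open>h\<close> numbers the triples, because \<open>graph_on\<close> requires
  the vertex set \<open>{..<n}\<close>.\<close>

definition shift_graph :: "nat \<Rightarrow> (nat \<Rightarrow> nat \<times> nat \<times> nat) \<Rightarrow> nat pair_pre_digraph" where
  "shift_graph n h =
     \<lparr>pverts = {..<n},
      parcs = {(i, j) \<in> {..<n} \<times> {..<n}. shift_adj (h i) (h j) \<or> shift_adj (h j) (h i)}\<rparr>"

lemma finite_shift_triples: "finite (shift_triples N)"
  by (rule finite_subset[of _ "{..<N} \<times> {..<N} \<times> {..<N}"]) (auto simp: shift_triples_def)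

lemma graph_on_shift_graph:
  assumes "h ` {..<n} \<subseteq> shift_triples N"
  shows "graph_on n (shift_graph n h)"
proof -
  have "\<not> shift_adj (h i) (h i)" if "i < n" for i
    using assms that by (force simp: shift_triples_def shift_adj_def)
  moreover have "finite (parcs (shift_graph n h))"
    by (rule finite_subset[of _ "{..<n} \<times> {..<n}"]) (auto simp: shift_graph_def)
  ultimately have "pair_graph (shift_graph n h)"
    by unfold_locales (auto simp: shift_graph_def symmetric_def intro!: symI)
  then show ?thesis
    by (simp add: graph_on_def shift_graph_def)
qed

lemma minrk_complement_shift_graph:
  assumes "h ` {..<n} \<subseteq> shift_triples N"
  shows "minrk n (complement_graph (shift_graph n h)) \<le> 3"
proof -
  define p where "p i = real (fst (h i))" for i
  define q where "q i = real (fst (snd (h i)))" for i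
  define r where "r i = real (snd (snd (h i)))" for i
  \<comment> \<open>These are the coefficients of \<open>(x - p i) * (x - r i)\<close>: the cross
    product of the two curve points, divided by \<open>r i - p i\<close>.\<close>
  define f where "f t i = [p i * r i, - (p i + r i), 1] ! t" for t i
  define g where "g t j = q j ^ t" for t j
  define M where "M = mat n n (\<lambda>(i, j). \<Sum>t<3. f t i * g t j)"
  have M: "M $$ (i, j) = (q j - p i) * (q j - r i)" if "i < n" "j < n" for i j
    using that by (simp add: M_def f_def g_def eval_nat_numeral algebra_simps)
  have "represents n M (complement_graph (shift_graph n h))"
    unfolding represents_def
  proof (intro conjI allI impI)
    show "M \<in> carrier_mat n n"
      by (simp add: M_def)
    show "M $$ (i, i) \<noteq> 0" if "i < n" for i
    proof -
      have "h i \<in> shift_triples N"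
        using assms that by auto
      then show ?thesis
        using that by (auto simp: M shift_triples_def p_def q_def r_def)
    qed
    show "M $$ (i, j) = 0"
      if "i < n" "j < n" "i \<noteq> j \<and> (i, j) \<notin> parcs (complement_graph (shift_graph n h))" for i j
    proof -
      have "shift_adj (h i) (h j) \<or> shift_adj (h j) (h i)"
        using that by (auto simp: complement_graph_def shift_graph_def)
      \<comment> \<open>The first adjacency gives \<open>q j = r i\<close>, the second
        \<open>q j = p i\<close>; either way one factor vanishes.\<close>
      then show ?thesis
        using that by (auto simp: M shift_adj_def p_def q_def r_def split: prod.splits)
    qed
  qed
  moreover have "vec_space.rank n M \<le> 3"
    unfolding M_def by (rule vec_space.rank_le_sum_products)
  ultimately show ?thesis
    by (rule minrk_le)
qed

lemma shift_graph_coloring_bound: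
  assumes h: "bij_betw h {..<n} (shift_triples N)"
    and c: "proper_coloring (shift_graph n h) k c"
  shows "N \<le> 2 ^ 2 ^ k"
proof -
  \<comment> \<open>Pulling \<open>c\<close> back along \<open>v\<close> colours the triples
    themselves.\<close>
  define v where "v = inv_into {..<n} h"
  have v: "v t < n" "h (v t) = t" if "t \<in> shift_triples N" for t
    using that bij_betw_inv_into_right[OF h] bij_betw_apply[OF bij_betw_inv_into[OF h]]
    by (auto simp: v_def)
  show ?thesis
  proof (rule shift_coloring_bound[where col = "\<lambda>x y z. c (v (x, y, z))"])
    fix x y z
    assume "x < y" "y < z" "z < N"
    then have "(x, y, z) \<in> shift_triples N"
      by (simp add: shift_triples_def)
    then have "v (x, y, z) \<in> pverts (shift_graph n h)"
      using v by (simp add: shift_graph_def)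
    then show "c (v (x, y, z)) < k"
      using c by (auto simp: proper_coloring_def)
  next
    fix w x y z
    assume "w < x" "x < y" "y < z" "z < N"
    then have "(w, x, y) \<in> shift_triples N" "(x, y, z) \<in> shift_triples N"
      by (auto simp: shift_triples_def)
    then have "(v (w, x, y), v (x, y, z)) \<in> parcs (shift_graph n h)"
      using v by (simp add: shift_graph_def shift_adj_def)
    then show "c (v (w, x, y)) \<noteq> c (v (x, y, z))"
      using c by (auto simp: proper_coloring_def)
  qed
qed

theorem theorem3p15:
  fixes m :: int
  shows "\<exists>n G. graph_on n G \<and> minrk n (complement_graph G) \<le> 3 \<and> int (chromatic_number G) \<ge> m"
proof -
  \<comment> \<open>With this \<open>N\<close>, the bound \<open>N \<le> 2 ^ 2 ^ k\<close> forces
    \<open>nat m \<le> k\<close>; a negative \<open>m\<close> is treated as 0.\<close>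
  define N :: nat where "N = 2 ^ 2 ^ nat m"
  obtain h and n :: nat where h: "bij_betw h {..<n} (shift_triples N)"
    using ex_bij_betw_nat_finite[OF finite_shift_triples[of N]] unfolding atLeast0LessThan by blast
  let ?G = "shift_graph n h"
  have im: "h ` {..<n} \<subseteq> shift_triples N"
    using h by (simp add: bij_betw_def)
  obtain c where "proper_coloring ?G (chromatic_number ?G) c"
    using chromatic_number_coloring[OF graph_on_shift_graph[OF im]] by blast
  then have "N \<le> 2 ^ 2 ^ chromatic_number ?G"
    by (rule shift_graph_coloring_bound[OF h])
  then have "nat m \<le> chromatic_number ?G"
    by (simp add: N_def)
  then show ?thesis
    using graph_on_shift_graph[OF im] minrk_complement_shift_graph[OF im] by (metis nat_le_iff)
qed

end
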